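(* Let $k,d\in\mathbb{N}$ with $k\le d$, let $A_1,\dots,A_k\subseteq\overline{\mathbb{R}}$ be non-empty subsets and $A:=A_1\times\dots\times A_k$. Let $g_1,\dots,g_d:A\to[0,1]$ and $f:\{0,1\}^d\to\mathbb{R}$ be given, and define $h:A\to\mathbb{R}$ by $$h(x):=\sum_{\alpha\subseteq[d]} f(\alpha)\prod_{i\in\alpha}g_i(x)\prod_{j\in[d]\setminus\alpha}\bigl(1-g_j(x)\bigr),$$ with empty products equal to $1$. If $g_1,\dots,g_d$ are fully $k$-alternating (as functions on $A\subseteq\overline{\mathbb{R}}^k$) and $f$ is fully $k$-alternating (as a function on $\{0,1\}^d$), then $h$ is fully $k$-alternating on $A$.
   Context: Notation: $[d]=\{1,\dots,d\}$; a subset $\alpha\subseteq[d]$ is identified with its indicator vector $1_\alpha\in\{0,1\}^d$, so $f(\alpha)=f(1_\alpha)$. For $\mathbf p\in\{0,1\}^m$ write $|\mathbf p|=\sum_i p_i$, and for vectors $x\odot y=(x_1y_1,x_2y_2,\dots)$; $\le$ on vectors is coordinatewise. Let $I=I_1\times\dots\times I_m$ with non-empty $I_j\subseteq\overline{\mathbb{R}}$ and $F:I\to\mathbb{R}$. For $s\in I$, $h\in\mathbb{R}_+^m$ (with $\pm\infty+t=\pm\infty$) and $\mathbf p\in\{0,1\}^m$ put $$(\nabla^{\mathbf p}_h F)(s):=(-1)^{|\mathbf p|}\sum_{\mathbf q\in\{0,1\}^m,\ \mathbf q\le\mathbf p}(-1)^{|\mathbf p|-|\mathbf q|}F(s+\mathbf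 q\odot h)=\sum_{\mathbf q\le\mathbf p}(-1)^{|\mathbf q|}F(s+\mathbf q\odot h).$$ For $1\le k\le m$, $F$ is called fully $k$-alternating if $(\nabla^{\mathbf p}_hF)(s)\le0$ for every $\mathbf p\in\{0,1\}^m$ with $\mathbf p\ne0$ and $|\mathbf p|\le k$, and every $s\in I$, $h\in\mathbb{R}_+^m$ such that $s+\mathbf q\odot h\in I$ for all $\mathbf q\in\{0,1\}^m$ with $\mathbf q\le\mathbf p$. (For $g_i$ on $A$ one has $m=k$; for $f$ on $\{0,1\}^d$ one has $m=d$, $I_j=\{0,1\}$.) For $k=2$ on $\{0,1\}^d$ this is the notion of an increasing submodular set function. *)

theory Defs
  imports "HOL-Library.Extended_Real" "HOL-Library.FuncSet"
begin

text \<open>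
  Vectors of length \<open>m\<close> are functions on \<open>{1..m}\<close> that are \<open>undefined\<close> elsewhere, so that
  \<open>I\<^sub>1 \<times> \<dots> \<times> I\<^sub>m\<close> is \<open>Pi\<^sub>E {1..m} I\<close>. Functions on such a product are
  total HOL functions; their values outside the product are never used.
\<close>

definition prod_box :: "nat \<Rightarrow> (nat \<Rightarrow> 'a set) \<Rightarrow> (nat \<Rightarrow> 'a) set" where
  "prod_box m I = Pi\<^sub>E {1..m} I"

definition bits :: "nat \<Rightarrow> (nat \<Rightarrow> nat) set" where
  "bits m = prod_box m (\<lambda>_. {0, 1})"

definition wt :: "nat \<Rightarrow> (nat \<Rightarrow> nat) \<Rightarrow> nat" where
  "wt m p = (\<Sum>i = 1..m. p i)"

definition sub_bits :: "nat \<Rightarrow> (nat \<Rightarrow> nat) \<Rightarrow> (nat \<Rightarrow> nat) set" where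
  "sub_bits m p = {q \<in> bits m. \<forall>i\<in>{1..m}. q i \<le> p i}"

text \<open>
  The vector \<open>s + q \<odot> h\<close>. Since \<open>h\<close> is real-valued, addition on \<^typ>\<open>ereal\<close> satisfies
  \<open>\<plusminus>\<infinity> + t = \<plusminus>\<infinity>\<close> here.
\<close>

definition shift_vec :: "nat \<Rightarrow> (nat \<Rightarrow> ereal) \<Rightarrow> (nat \<Rightarrow> nat) \<Rightarrow> (nat \<Rightarrow> real) \<Rightarrow> nat \<Rightarrow> ereal" where
  "shift_vec m s q h = (\<lambda>j\<in>{1..m}. s j + ereal (real (q j) * h j))"

definition nabla ::
  "nat \<Rightarrow> (nat \<Rightarrow> nat) \<Rightarrow> (nat \<Rightarrow> real) \<Rightarrow> ((nat \<Rightarrow> ereal) \<Rightarrow> real) \<Rightarrow> (nat \<Rightarrow> ereal) \<Rightarrow> real" where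
  "nabla m p h F s =
     (-1) ^ wt m p * (\<Sum>q\<in>sub_bits m p. (-1) ^ (wt m p - wt m q) * F (shift_vec m s q h))"

lemma nabla_altdef:
  "nabla m p h F s = (\<Sum>q\<in>sub_bits m p. (-1) ^ wt m q * F (shift_vec m s q h))"
proof -
  have "(-1) ^ wt m p * ((-1) ^ (wt m p - wt m q) * F (shift_vec m s q h))
      = (-1) ^ wt m q * F (shift_vec m s q h)" if "q \<in> sub_bits m p" for q
  proof -
    have "wt m q \<le> wt m p"
      using that unfolding wt_def sub_bits_def by (intro sum_mono) auto
    then have "wt m p + (wt m p - wt m q) = wt m q + 2 * (wt m p - wt m q)"
      by simp
    then have "(-1 :: real) ^ wt m p * (-1) ^ (wt m p - wt m q) = (-1) ^ wt m q"
      by (metis minus_one_power_iff even_add even_mult_iff even_numeral power_add)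
    then show ?thesis
      by (simp flip: mult.assoc)
  qed
  then show ?thesis
    unfolding nabla_def sum_distrib_left by (intro sum.cong) auto
qed

text \<open>
  \<open>fully_alternating m k I F\<close>: the function \<open>F\<close> on \<open>I\<^sub>1 \<times> \<dots> \<times> I\<^sub>m\<close> is fully
  \<open>k\<close>-alternating, for \<open>1 \<le> k \<le> m\<close> and non-empty \<open>I\<^sub>j\<close>. The condition \<open>p \<noteq> 0\<close> is
  \<open>wt m p \<noteq> 0\<close>.
\<close>

definition fully_alternating ::
  "nat \<Rightarrow> nat \<Rightarrow> (nat \<Rightarrow> ereal set) \<Rightarrow> ((nat \<Rightarrow> ereal) \<Rightarrow> real) \<Rightarrow> bool" where
  "fully_alternating m k I F \<longleftrightarrow>
     (\<forall>p\<in>bits m. \<forall>s\<in>prod_box m I. \<forall>h.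
        wt m p \<noteq> 0 \<and> wt m p \<le> k \<and> (\<forall>j\<in>{1..m}. 0 \<le> h j) \<and>
        (\<forall>q\<in>sub_bits m p. shift_vec m s q h \<in> prod_box m I)
        \<longrightarrow> nabla m p h F s \<le> 0)"

definition ind_vec :: "nat \<Rightarrow> nat set \<Rightarrow> nat \<Rightarrow> ereal" where
  "ind_vec d \<alpha> = (\<lambda>j\<in>{1..d}. if j \<in> \<alpha> then 1 else 0)"

end

theory Submission
  imports Defs
begin

text \<open>
  Fix a base point and a direction \<open>p\<close> with support \<open>P\<close>. Along the cube spanned by them, each
  \<open>g\<^sub>i\<close> is a function \<open>G\<^sub>i\<close> of \<open>Q \<subseteq> P\<close>, and by Moebius inversion full alternation says that
  \<open>G\<^sub>i\<close> is a convex combination of the constant \<open>1\<close> and the hitting functions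
  \<open>Q \<mapsto> [T \<inter> Q \<noteq> \<emptyset>]\<close>, \<open>T \<subseteq> P\<close>. Since \<open>h\<close> is affine in each \<open>g\<^sub>i\<close>, all \<open>G\<^sub>i\<close> may be
  assumed to be of this form. Then \<open>h\<close> becomes \<open>f (X \<union> (\<Union>q\<in>Q. B q))\<close> for some sets \<open>X\<close> and \<open>B q\<close>,
  and its alternating sum is nonpositive because the differences of \<open>f\<close> in the directions \<open>B q\<close>
  telescope into differences in single coordinates.
\<close>

section \<open>Alternating sums over subsets\<close>

text \<open>This is \<open>nabla\<close> with \<open>P\<close> the support of its direction and
  \<open>u Q\<close> the value at the vertex of the cube indexed by \<open>Q\<close>. With this
  sign, a single direction gives \<open>u {} - u {q}\<close>.\<close>

definition altsum :: "'a set \<Rightarrow> ('a set \<Rightarrow> real) \<Rightarrow> real" where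
  "altsum P u = (\<Sum>Q\<in>Pow P. (-1) ^ card Q * u Q)"

lemma sum_Pow_insert:
  assumes "finite A" "a \<notin> A"
  shows "sum u (Pow (insert a A)) = sum u (Pow A) + (\<Sum>B\<in>Pow A. u (insert a B))"
proof -
  have "inj_on (insert a) (Pow A)"
    using assms(2) by (auto intro!: inj_onI)
  then have "sum u (insert a ` Pow A) = (\<Sum>B\<in>Pow A. u (insert a B))"
    by (simp add: sum.reindex)
  moreover have "sum u (Pow (insert a A)) = sum u (Pow A) + sum u (insert a ` Pow A)"
    unfolding Pow_insert using assms by (intro sum.union_disjoint) auto
  ultimately show ?thesis by simp
qed

lemma altsum_empty [simp]: "altsum {} u = u {}"
  by (simp add: altsum_def)

lemma altsum_cong:
  "(\<And>Q. Q \<subseteq> P \<Longrightarrow> u Q = v Q) \<Longrightarrow> altsum P u = altsum P v"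
  unfolding altsum_def by (intro sum.cong) auto

lemma altsum_add: "altsum P (\<lambda>Q. u Q + v Q) = altsum P u + altsum P v"
  by (simp add: altsum_def algebra_simps sum.distrib)

lemma altsum_diff: "altsum P (\<lambda>Q. u Q - v Q) = altsum P u - altsum P v"
  by (simp add: altsum_def algebra_simps sum_subtractf)

lemma altsum_scale: "altsum P (\<lambda>Q. c * u Q) = c * altsum P u"
  by (simp add: altsum_def sum_distrib_left algebra_simps)

lemma altsum_sum: "altsum P (\<lambda>Q. \<Sum>t\<in>S. u t Q) = (\<Sum>t\<in>S. altsum P (u t))"
  unfolding altsum_def sum_distrib_left by (rule sum.swap)

lemma altsum_insert:
  assumes "finite P" "q \<notin> P"
  shows "altsum (insert q P) u = altsum P (\<lambda>Q. u Q - u (insert q Q))"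
proof -
  have "(-1) ^ card (insert q Q) = - ((-1) ^ card Q :: real)" if "Q \<subseteq> P" for Q
    using that assms by (subst card_insert_disjoint) (auto dest: finite_subset)
  then show ?thesis
    unfolding altsum_def sum_Pow_insert[OF assms] sum.distrib[symmetric]
    by (intro sum.cong) (auto simp: algebra_simps)
qed

lemma altsum_eq_0:
  assumes "finite P" "q \<in> P" "\<And>Q. Q \<subseteq> P \<Longrightarrow> u (insert q Q) = u Q"
  shows "altsum P u = 0"
proof -
  have "altsum P u = altsum (P - {q}) (\<lambda>Q. u Q - u (insert q Q))"
    using altsum_insert[of "P - {q}" q u] assms by (simp add: insert_absorb)
  also have "\<dots> = altsum (P - {q}) (\<lambda>Q. 0)"
  proof (rule altsum_cong)
    fix Q assume "Q \<subseteq> P - {q}"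
    then have "Q \<subseteq> P" by blast
    then show "u Q - u (insert q Q) = 0" by (simp add: assms(3))
  qed
  finally show ?thesis
    by (simp add: altsum_def)
qed

text \<open>The summand is the Moebius transform of \<open>u\<close> at \<open>T\<close>: with
  \<open>W = T - V\<close>, the value \<open>u W\<close> carries the sign of
  \<open>card (T - W)\<close>. In the induction, the sets containing the new \<open>s\<close>
  contribute exactly \<open>u (insert s S) - u S\<close>.\<close>

lemma moebius_inversion:
  assumes "finite S"
  shows "(\<Sum>T\<in>Pow S. altsum T (\<lambda>V. u (T - V))) = u S"
  using assms
proof (induction S arbitrary: u rule: finite_induct)
  case empty
  then show ?case by simp
next
  case (insert s S)
  have "altsum (insert s T) (\<lambda>V. u (insert s T - V))
      = altsum T (\<lambda>V. u (insert s (T - V))) - altsum T (\<lambda>V. u (T - V))"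
    if "T \<in> Pow S" for T
  proof -
    have T: "finite T" "s \<notin> T"
      using that insert.hyps finite_subset by auto
    show ?thesis
      unfolding altsum_insert[OF T] altsum_diff[symmetric]
    proof (rule altsum_cong)
      fix V assume "V \<subseteq> T"
      then have "insert s T - V = insert s (T - V)" "insert s T - insert s V = T - V"
        using T by auto
      then show "u (insert s T - V) - u (insert s T - insert s V) = u (insert s (T - V)) - u (T - V)"
        by simp
    qed
  qed
  then have "(\<Sum>T\<in>Pow S. altsum (insert s T) (\<lambda>V. u (insert s T - V))) = u (insert s S) - u S"
    using insert.IH[of u] insert.IH[of "\<lambda>T. u (insert s T)"] by (simp add: sum_subtractf)
  then show ?case
    using insert.IH[of u] insert.hyps by (simp add: sum_Pow_insert)
qed

section \<open>Alternating set functions\<close>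

text \<open>Adding the elements of \<open>B\<close> one at a time telescopes the difference into
  differences in single coordinates. Each raises the order by at most one, hence
  \<open>Suc n\<close> in the hypothesis. For \<open>R = {}\<close> each is itself a difference of
  order one.\<close>

lemma altsum_union_difference_nonpos:
  assumes "finite D"
    and alt: "\<And>X R. X \<subseteq> D \<Longrightarrow> R \<subseteq> D \<Longrightarrow> R \<noteq> {} \<Longrightarrow> card R \<le> Suc n \<Longrightarrow>
      altsum R (\<lambda>V. F (X \<union> V)) \<le> 0"
    and "X \<subseteq> D" "R \<subseteq> D" "card R \<le> n" "B \<subseteq> D"
  shows "altsum R (\<lambda>V. F (X \<union> V) - F (B \<union> (X \<union> V))) \<le> 0"
proof -
  have fR: "finite R" using \<open>R \<subseteq> D\<close> \<open>finite D\<close> by (rule finite_subset)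
  have "finite B" using \<open>B \<subseteq> D\<close> \<open>finite D\<close> by (rule finite_subset)
  then show ?thesis
    using \<open>X \<subseteq> D\<close> \<open>B \<subseteq> D\<close>
  proof (induction B arbitrary: X rule: finite_induct)
    case empty
    then show ?case by (simp add: altsum_def)
  next
    case (insert b B)
    have single: "altsum R (\<lambda>V. F (X \<union> V) - F (insert b X \<union> V)) \<le> 0"
    proof (cases "b \<in> R")
      case True
      \<comment> \<open>With \<open>b\<close> in the base, the term no longer depends on whether
        \<open>b \<in> V\<close>, so it cancels in pairs.\<close>
      have "altsum R (\<lambda>V. F (insert b X \<union> V)) = 0"
        by (rule altsum_eq_0[OF fR True]) simp
      moreover have "altsum R (\<lambda>V. F (X \<union> V)) \<le> 0"
        using True insert.prems assms by (intro alt) auto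
      ultimately show ?thesis by (simp add: altsum_diff)
    next
      case False
      have "altsum R (\<lambda>V. F (X \<union> V) - F (insert b X \<union> V)) = altsum (insert b R) (\<lambda>V. F (X \<union> V))"
        by (simp add: altsum_insert fR False)
      also have "\<dots> \<le> 0"
        using insert.prems assms fR False by (intro alt) auto
      finally show ?thesis .
    qed
    have rest: "altsum R (\<lambda>V. F (insert b X \<union> V) - F (B \<union> (insert b X \<union> V))) \<le> 0"
      using insert.prems by (intro insert.IH) auto
    show ?case
      using single rest by (simp add: altsum_diff)
  qed
qed

text \<open>
  The case \<open>R = {}\<close> of the hypothesis says \<open>F \<le> 0\<close>; it is only available for the differences of
  \<open>f\<close>, not for \<open>f\<close> itself, and it is only needed when \<open>P\<close> is exhausted.
\<close>

lemma altsum_Union_nonpos: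
  assumes "finite P" "finite D"
    and "\<And>X R. X \<subseteq> D \<Longrightarrow> R \<subseteq> D \<Longrightarrow> R \<noteq> {} \<or> P = {} \<Longrightarrow> card R \<le> card P \<Longrightarrow>
      altsum R (\<lambda>V. F (X \<union> V)) \<le> 0"
    and "X \<subseteq> D" "\<And>q. q \<in> P \<Longrightarrow> B q \<subseteq> D"
  shows "altsum P (\<lambda>Q. F (X \<union> (\<Union>q\<in>Q. B q))) \<le> 0"
  using assms(1,3,5)
proof (induction P arbitrary: F rule: finite_induct)
  case empty
  from empty.prems(1)[of X "{}"] \<open>X \<subseteq> D\<close> show ?case by simp
next
  case (insert q P)
  \<comment> \<open>Peeling off \<open>q\<close> trades one direction for a difference of
    \<open>F\<close> along \<open>B q\<close>; the available order drops by one, and order zero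
    becomes available for \<open>F'\<close>.\<close>
  define F' where "F' Y = F Y - F (B q \<union> Y)" for Y
  have "altsum (insert q P) (\<lambda>Q. F (X \<union> (\<Union>q\<in>Q. B q))) = altsum P (\<lambda>Q. F' (X \<union> (\<Union>q\<in>Q. B q)))"
    unfolding altsum_insert[OF insert.hyps] F'_def
    by (intro altsum_cong) (simp add: Un_left_commute)
  also have "\<dots> \<le> 0"
  proof (rule insert.IH)
    fix X R assume "X \<subseteq> D" "R \<subseteq> D" "card R \<le> card P"
    then show "altsum R (\<lambda>V. F' (X \<union> V)) \<le> 0"
      unfolding F'_def using insert.prems insert.hyps
      by (intro altsum_union_difference_nonpos[OF \<open>finite D\<close>]) auto
  qed (use insert.prems in auto)
  finally show ?case .
qed

text \<open>For \<open>T \<noteq> {}\<close>, alternation makes the weight \<open>m T\<close>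
  nonnegative; for \<open>m {}\<close> and \<open>c\<close> this comes from
  \<open>G P \<le> 1\<close> and \<open>0 \<le> G {}\<close>. Comparing both expansions at
  \<open>Q = {}\<close> shows that the total weight is 1.\<close>

lemma alternating_convex_combination:
  assumes "finite P"
    and alt: "\<And>U R. U \<subseteq> P \<Longrightarrow> R \<subseteq> P \<Longrightarrow> R \<noteq> {} \<Longrightarrow> U \<inter> R = {} \<Longrightarrow> altsum R (\<lambda>V. G (U \<union> V)) \<le> 0"
    and G01: "\<And>Q. Q \<subseteq> P \<Longrightarrow> G Q \<in> {0..1}"
  obtains c m where "0 \<le> c" "\<And>T. T \<subseteq> P \<Longrightarrow> 0 \<le> m T"
    "\<And>Q. Q \<subseteq> P \<Longrightarrow> G Q = c + (\<Sum>T\<in>Pow P. m T * of_bool (T \<inter> Q \<noteq> {}))"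
    "\<And>Q. Q \<subseteq> P \<Longrightarrow> 1 - G Q = (\<Sum>T\<in>Pow P. m T * of_bool (T \<inter> Q = {}))"
proof
  \<comment> \<open>Complementation turns the sets \<open>T\<close> that miss \<open>Q\<close> into
    the subsets of \<open>P - Q\<close>, over which Moebius inversion sums.\<close>
  define u where "u S = 1 - G (P - S)" for S
  define m where "m T = altsum T (\<lambda>V. u (T - V))" for T
  show "0 \<le> G {}" using G01[of "{}"] by simp
  show "0 \<le> m T" if "T \<subseteq> P" for T
  proof (cases "T = {}")
    case True
    then show ?thesis using G01[of P] by (simp add: m_def u_def)
  next
    case False
    have "finite T" using that assms(1) finite_subset by blast
    then have "altsum T (\<lambda>_. 1) = 0"
      using False by (auto intro: altsum_eq_0)
    \<comment> \<open>The constant 1 drops out, so \<open>m T\<close> is minus a difference of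
      \<open>G\<close> based at \<open>P - T\<close>.\<close>
    moreover have "m T = altsum T (\<lambda>V. 1 - G ((P - T) \<union> V))"
      unfolding m_def u_def
    proof (rule altsum_cong)
      fix V assume "V \<subseteq> T"
      then have "P - (T - V) = (P - T) \<union> V" using that by auto
      then show "1 - G (P - (T - V)) = 1 - G ((P - T) \<union> V)" by simp
    qed
    ultimately show ?thesis
      using alt[of "P - T" T] that False by (auto simp: altsum_diff)
  qed
  have compl: "1 - G Q = (\<Sum>T\<in>Pow P. m T * of_bool (T \<inter> Q = {}))" if "Q \<subseteq> P" for Q
  proof -
    have "P - (P - Q) = Q" using that by auto
    then have "1 - G Q = (\<Sum>T\<in>Pow (P - Q). m T)"
      using moebius_inversion[of "P - Q" u] assms(1) by (simp add: m_def u_def)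
    also have "\<dots> = (\<Sum>T\<in>Pow P. m T * of_bool (T \<inter> Q = {}))"
      using assms(1) by (intro sum.mono_neutral_cong_left) auto
    finally show ?thesis .
  qed
  then show "1 - G Q = (\<Sum>T\<in>Pow P. m T * of_bool (T \<inter> Q = {}))" if "Q \<subseteq> P" for Q
    using that by blast
  show "G Q = G {} + (\<Sum>T\<in>Pow P. m T * of_bool (T \<inter> Q \<noteq> {}))" if "Q \<subseteq> P" for Q
  proof -
    \<comment> \<open>The sets missing \<open>Q\<close> and those hitting it together carry the mass
      \<open>1 - G {}\<close>, by \<open>compl\<close> at the empty set.\<close>
    have "(\<Sum>T\<in>Pow P. m T * of_bool (T \<inter> Q = {})) + (\<Sum>T\<in>Pow P. m T * of_bool (T \<inter> Q \<noteq> {}))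
        = (\<Sum>T\<in>Pow P. m T * of_bool (T \<inter> {} = {}))"
      unfolding sum.distrib[symmetric] by (intro sum.cong) auto
    then show ?thesis
      using compl[OF that] compl[of "{}"] by simp
  qed
qed

section \<open>The multilinear extension\<close>

text \<open>For \<open>x\<close> in the unit cube, this is the expectation of \<open>f\<close> at a
  random subset of \<open>D\<close> containing each \<open>i\<close> independently with probability
  \<open>x i\<close>.\<close>

definition multilinear :: "'i set \<Rightarrow> ('i set \<Rightarrow> real) \<Rightarrow> ('i \<Rightarrow> real) \<Rightarrow> real" where
  "multilinear D f x = (\<Sum>\<alpha>\<in>Pow D. f \<alpha> * (\<Prod>i\<in>\<alpha>. x i) * (\<Prod>j\<in>D - \<alpha>. 1 - x j))"

text \<open>Condition on whether \<open>i\<close> is chosen. The result is again a multilinear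
  extension, of a modified set function, which permits induction on \<open>D\<close>.\<close>

lemma multilinear_insert:
  assumes "finite D" "i \<notin> D"
  shows "multilinear (insert i D) f x =
    multilinear D (\<lambda>\<alpha>. (1 - x i) * f \<alpha> + x i * f (insert i \<alpha>)) x"
proof -
  have "f \<alpha> * (\<Prod>i\<in>\<alpha>. x i) * (\<Prod>j\<in>insert i D - \<alpha>. 1 - x j) +
      f (insert i \<alpha>) * (\<Prod>i\<in>insert i \<alpha>. x i) * (\<Prod>j\<in>insert i D - insert i \<alpha>. 1 - x j) =
      ((1 - x i) * f \<alpha> + x i * f (insert i \<alpha>)) * (\<Prod>i\<in>\<alpha>. x i) * (\<Prod>j\<in>D - \<alpha>. 1 - x j)"
    if "\<alpha> \<in> Pow D" for \<alpha>
  proof -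
    have "finite \<alpha>" "i \<notin> \<alpha>" "insert i D - \<alpha> = insert i (D - \<alpha>)" "insert i D - insert i \<alpha> = D - \<alpha>"
      using that assms finite_subset by auto
    then show ?thesis using assms by (simp add: algebra_simps)
  qed
  then show ?thesis
    unfolding multilinear_def sum_Pow_insert[OF assms] sum.distrib[symmetric]
    by (intro sum.cong) auto
qed

text \<open>The last hypothesis is the extreme case: every \<open>G i\<close> is constantly 1 (if
  \<open>c i\<close>) or the hitting function of \<open>T i\<close>, and at 0-1 arguments the
  extension evaluates \<open>F\<close> at the set of ones. \<open>F\<close> depends on
  \<open>Q\<close> because eliminating a coordinate puts \<open>G i Q\<close> into the
  coefficients.\<close>

lemma altsum_multilinear_nonpos:
  assumes "finite D" "finite P"
    and "\<And>i U R. i \<in> D \<Longrightarrow> U \<subseteq> P \<Longrightarrow> R \<subseteq> P \<Longrightarrow> R \<noteq> {} \<Longrightarrow> U \<inter> R = {} \<Longrightarrow>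
      altsum R (\<lambda>V. G i (U \<union> V)) \<le> 0"
    and "\<And>i Q. i \<in> D \<Longrightarrow> Q \<subseteq> P \<Longrightarrow> G i Q \<in> {0..1}"
    and "\<And>c T. altsum P (\<lambda>Q. F {i\<in>D. c i \<or> T i \<inter> Q \<noteq> {}} Q) \<le> 0"
  shows "altsum P (\<lambda>Q. multilinear D (\<lambda>\<alpha>. F \<alpha> Q) (\<lambda>i. G i Q)) \<le> 0"
  using assms(1,3-)
proof (induction D arbitrary: F rule: finite_induct)
  case empty
  then show ?case by (simp add: multilinear_def)
next
  case (insert i D)
  obtain c0 m where c0: "0 \<le> c0" and m: "\<And>T. T \<subseteq> P \<Longrightarrow> 0 \<le> m T"
    and G: "\<And>Q. Q \<subseteq> P \<Longrightarrow> G i Q = c0 + (\<Sum>T\<in>Pow P. m T * of_bool (T \<inter> Q \<noteq> {}))"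
    and G': "\<And>Q. Q \<subseteq> P \<Longrightarrow> 1 - G i Q = (\<Sum>T\<in>Pow P. m T * of_bool (T \<inter> Q = {}))"
    using alternating_convex_combination[of P "G i"] assms(2) insert.prems(1,2) by blast
  have "altsum P (\<lambda>Q. multilinear D
      (\<lambda>\<alpha>. (1 - G i Q) * F \<alpha> Q + G i Q * F (insert i \<alpha>) Q) (\<lambda>i. G i Q)) \<le> 0"
  proof (rule insert.IH)
    fix c :: "'a \<Rightarrow> bool" and T :: "'a \<Rightarrow> 'b set"
    \<comment> \<open>\<open>S Q\<close> is the set of ones among the remaining coordinates;
      \<open>W U Q\<close> is the value of \<open>F\<close> when \<open>G i\<close> is replaced by
      the hitting function of \<open>U\<close>.\<close>
    define S where "S Q = {j\<in>D. c j \<or> T j \<inter> Q \<noteq> {}}" for Q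
    define W where "W U Q = (if U \<inter> Q \<noteq> {} then F (insert i (S Q)) Q else F (S Q) Q)" for U Q
    have always: "altsum P (\<lambda>Q. F (insert i (S Q)) Q) \<le> 0"
    proof -
      have "insert i (S Q) = {j\<in>insert i D. (c(i := True)) j \<or> T j \<inter> Q \<noteq> {}}" for Q
        using insert.hyps by (auto simp: S_def)
      then show ?thesis using insert.prems(3)[of "c(i := True)" T] by simp
    qed
    have hit: "altsum P (W U) \<le> 0" for U
    proof -
      have "{j\<in>insert i D. (c(i := False)) j \<or> (T(i := U)) j \<inter> Q \<noteq> {}}
          = (if U \<inter> Q \<noteq> {} then insert i (S Q) else S Q)" for Q
        using insert.hyps by (auto simp: S_def)
      then have "W U = (\<lambda>Q. F {j\<in>insert i D. (c(i := False)) j \<or> (T(i := U)) j \<inter> Q \<noteq> {}} Q)"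
        by (auto simp: W_def fun_eq_iff)
      then show ?thesis using insert.prems(3)[of "c(i := False)" "T(i := U)"] by simp
    qed
    \<comment> \<open>Expanding both \<open>G i Q\<close> and \<open>1 - G i Q\<close> gives a
      combination of extreme cases with nonnegative weights \<open>c0\<close> and
      \<open>m U\<close>.\<close>
    have "altsum P (\<lambda>Q. (1 - G i Q) * F (S Q) Q + G i Q * F (insert i (S Q)) Q)
        = altsum P (\<lambda>Q. c0 * F (insert i (S Q)) Q + (\<Sum>U\<in>Pow P. m U * W U Q))"
    proof (rule altsum_cong)
      fix Q assume Q: "Q \<subseteq> P"
      have "(\<Sum>U\<in>Pow P. m U * W U Q) =
          (\<Sum>U\<in>Pow P. m U * of_bool (U \<inter> Q = {})) * F (S Q) Q +
          (\<Sum>U\<in>Pow P. m U * of_bool (U \<inter> Q \<noteq> {})) * F (insert i (S Q)) Q"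
        unfolding sum_distrib_right sum.distrib[symmetric] W_def by (intro sum.cong) auto
      then show "(1 - G i Q) * F (S Q) Q + G i Q * F (insert i (S Q)) Q =
          c0 * F (insert i (S Q)) Q + (\<Sum>U\<in>Pow P. m U * W U Q)"
        unfolding G'[OF Q] by (simp add: G[OF Q] algebra_simps)
    qed
    also have "\<dots> = c0 * altsum P (\<lambda>Q. F (insert i (S Q)) Q) + (\<Sum>U\<in>Pow P. m U * altsum P (W U))"
      by (simp add: altsum_add altsum_scale altsum_sum)
    also have "\<dots> \<le> 0"
      using c0 m always hit
      by (intro add_nonpos_nonpos sum_nonpos mult_nonneg_nonpos) auto
    finally show "altsum P (\<lambda>Q. (1 - G i Q) * F {j\<in>D. c j \<or> T j \<inter> Q \<noteq> {}} Q +
        G i Q * F (insert i {j\<in>D. c j \<or> T j \<inter> Q \<noteq> {}}) Q) \<le> 0"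
      unfolding S_def .
  qed (use insert.prems in auto)
  then show ?case
    by (simp add: multilinear_insert insert.hyps)
qed

section \<open>Subsets as 0-1 vectors\<close>

definition bitvec :: "nat \<Rightarrow> nat set \<Rightarrow> nat \<Rightarrow> nat" where
  "bitvec m S = (\<lambda>j\<in>{1..m}. of_bool (j \<in> S))"

lemma bits_eq_bitvec:
  assumes "p \<in> bits m"
  obtains S where "S \<subseteq> {1..m}" "p = bitvec m S"
proof
  show "p = bitvec m {i\<in>{1..m}. p i = 1}"
    using assms by (fastforce simp: bits_def prod_box_def bitvec_def PiE_iff extensional_def fun_eq_iff)
qed auto

lemma bitvec_in_bits: "bitvec m S \<in> bits m"
  by (auto simp: bits_def prod_box_def bitvec_def)

lemma wt_bitvec: "S \<subseteq> {1..m} \<Longrightarrow> wt m (bitvec m S) = card S"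
  by (simp add: wt_def bitvec_def Int_absorb1 flip: sum.inter_restrict card_eq_sum)

lemma bitvec_inj: "inj_on (bitvec m) (Pow {1..m})"
proof (rule inj_onI)
  fix S T assume ST: "S \<in> Pow {1..m}" "T \<in> Pow {1..m}" and eq: "bitvec m S = bitvec m T"
  have "(j \<in> S) = (j \<in> T)" if "j \<in> {1..m}" for j
  proof -
    have "bitvec m S j = bitvec m T j" by (simp only: eq)
    then show ?thesis
      using that by (simp add: bitvec_def of_bool_eq_iff)
  qed
  with ST show "S = T" by blast
qed

lemma sub_bits_bitvec:
  assumes "R \<subseteq> {1..m}"
  shows "sub_bits m (bitvec m R) = bitvec m ` Pow R"
proof
  show "bitvec m ` Pow R \<subseteq> sub_bits m (bitvec m R)"
    using bitvec_in_bits by (fastforce simp: sub_bits_def bitvec_def)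
  show "sub_bits m (bitvec m R) \<subseteq> bitvec m ` Pow R"
  proof
    fix q assume q: "q \<in> sub_bits m (bitvec m R)"
    then obtain S where S: "S \<subseteq> {1..m}" "q = bitvec m S"
      by (auto simp: sub_bits_def elim: bits_eq_bitvec)
    have "S \<subseteq> R"
    proof
      fix j assume "j \<in> S"
      with q S have "j \<in> {1..m}" "q j \<le> bitvec m R j" "q j = 1"
        by (auto simp: sub_bits_def bitvec_def)
      then show "j \<in> R" by (cases "j \<in> R") (auto simp: bitvec_def)
    qed
    with S show "q \<in> bitvec m ` Pow R" by blast
  qed
qed

lemma nabla_bitvec:
  assumes "R \<subseteq> {1..m}"
  shows "nabla m (bitvec m R) h F s = altsum R (\<lambda>V. F (shift_vec m s (bitvec m V) h))"
proof -
  have "inj_on (bitvec m) (Pow R)"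
    using bitvec_inj by (rule inj_on_subset) (use assms in auto)
  then show ?thesis
    unfolding nabla_altdef sub_bits_bitvec[OF assms] altsum_def
    using assms by (auto simp: sum.reindex wt_bitvec intro!: sum.cong)
qed

text \<open>A 0-1 vector is determined by its support: its weight is the cardinality, and the
  vectors below it correspond to subsets.\<close>

lemma fully_alternating_iff:
  "fully_alternating m k I F \<longleftrightarrow>
    (\<forall>R s h. R \<subseteq> {1..m} \<and> R \<noteq> {} \<and> card R \<le> k \<and> s \<in> prod_box m I \<and> (\<forall>j\<in>{1..m}. 0 \<le> h j) \<and>
      (\<forall>V\<subseteq>R. shift_vec m s (bitvec m V) h \<in> prod_box m I) \<longrightarrow>
      altsum R (\<lambda>V. F (shift_vec m s (bitvec m V) h)) \<le> 0)"
  (is "_ \<longleftrightarrow> ?rhs")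
proof
  assume L: "fully_alternating m k I F"
  show ?rhs
  proof (intro allI impI, elim conjE)
    fix R s h
    assume R: "R \<subseteq> {1..m}" "R \<noteq> {}" "card R \<le> k" and *: "s \<in> prod_box m I" "\<forall>j\<in>{1..m}. 0 \<le> h j"
      "\<forall>V\<subseteq>R. shift_vec m s (bitvec m V) h \<in> prod_box m I"
    have "finite R" using R(1) finite_subset by blast
    then have "card R \<noteq> 0" using R(2) by simp
    then have "nabla m (bitvec m R) h F s \<le> 0"
      using L[unfolded fully_alternating_def, rule_format, OF bitvec_in_bits *(1), of R h] R *
      by (simp add: wt_bitvec sub_bits_bitvec)
    then show "altsum R (\<lambda>V. F (shift_vec m s (bitvec m V) h)) \<le> 0"
      by (simp add: nabla_bitvec[OF R(1)])
  qed
next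
  assume R: ?rhs
  show "fully_alternating m k I F"
    unfolding fully_alternating_def
  proof (intro ballI allI impI, elim conjE)
    fix p s h
    assume p: "p \<in> bits m" "wt m p \<noteq> 0" "wt m p \<le> k" and *: "s \<in> prod_box m I" "\<forall>j\<in>{1..m}. 0 \<le> h j"
      "\<forall>q\<in>sub_bits m p. shift_vec m s q h \<in> prod_box m I"
    obtain S where S: "S \<subseteq> {1..m}" "p = bitvec m S"
      using p(1) by (rule bits_eq_bitvec)
    then have "S \<noteq> {}" "card S \<le> k"
      using p by (auto simp: wt_bitvec)
    then show "nabla m p h F s \<le> 0"
      using R S * by (simp add: nabla_bitvec sub_bits_bitvec)
  qed
qed

text \<open>By disjointness each coordinate moves at most once, so a face of a cube is a cube with
  the same step vector.\<close>

lemma shift_vec_shift_vec: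
  assumes "U \<inter> V = {}"
  shows "shift_vec m (shift_vec m s (bitvec m U) h) (bitvec m V) h = shift_vec m s (bitvec m (U \<union> V)) h"
  using assms by (fastforce simp: shift_vec_def bitvec_def fun_eq_iff zero_ereal_def[symmetric])

lemma shift_vec_ind_vec:
  assumes "X \<inter> V = {}"
  shows "shift_vec d (ind_vec d X) (bitvec d V) (\<lambda>_. 1) = ind_vec d (X \<union> V)"
  using assms
  by (fastforce simp: shift_vec_def bitvec_def ind_vec_def fun_eq_iff zero_ereal_def[symmetric] one_ereal_def[symmetric])

text \<open>For disjoint \<open>X\<close> and \<open>R\<close> this is a difference of
  \<open>f\<close> with unit steps. A common element makes the terms cancel in pairs; allowing
  overlap spares the telescoping any disjointness condition.\<close>

lemma fully_alternating_set_function: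
  assumes f: "fully_alternating d k (\<lambda>_. {0, 1}) f"
    and "X \<subseteq> {1..d}" "R \<subseteq> {1..d}" "R \<noteq> {}" "card R \<le> k"
  shows "altsum R (\<lambda>V. f (ind_vec d (X \<union> V))) \<le> 0"
proof (cases "X \<inter> R = {}")
  case True
  have box: "ind_vec d Y \<in> prod_box d (\<lambda>_. {0, 1})" for Y
    by (auto simp: ind_vec_def prod_box_def)
  have shift: "shift_vec d (ind_vec d X) (bitvec d V) (\<lambda>_. 1) = ind_vec d (X \<union> V)" if "V \<subseteq> R" for V
    using that True by (intro shift_vec_ind_vec) auto
  have "altsum R (\<lambda>V. f (shift_vec d (ind_vec d X) (bitvec d V) (\<lambda>_. 1))) \<le> 0"
    using f assms(2-) shift box unfolding fully_alternating_iff by simp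
  then show ?thesis
    using altsum_cong[of R "\<lambda>V. f (shift_vec d (ind_vec d X) (bitvec d V) (\<lambda>_. 1))"] shift by simp
next
  case False
  then obtain b where b: "b \<in> X" "b \<in> R" by blast
  have "finite R" using assms finite_subset by blast
  have "insert b (X \<union> V) = X \<union> V" for V using b by auto
  then have "altsum R (\<lambda>V. f (ind_vec d (X \<union> V))) = 0"
    using \<open>finite R\<close> b by (intro altsum_eq_0[of R b]) auto
  then show ?thesis by simp
qed

theorem theorem2:
  fixes k d :: nat
    and A :: "nat \<Rightarrow> ereal set"
    and g :: "nat \<Rightarrow> (nat \<Rightarrow> ereal) \<Rightarrow> real"
    and f :: "(nat \<Rightarrow> ereal) \<Rightarrow> real"
    and h :: "(nat \<Rightarrow> ereal) \<Rightarrow> real"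
  assumes "1 \<le> k" and "k \<le> d"
    and "\<And>j. j \<in> {1..k} \<Longrightarrow> A j \<noteq> {}"
    and "\<And>i x. i \<in> {1..d} \<Longrightarrow> x \<in> prod_box k A \<Longrightarrow> g i x \<in> {0..1}"
    and "\<And>x. x \<in> prod_box k A \<Longrightarrow>
           h x = (\<Sum>\<alpha>\<in>Pow {1..d}. f (ind_vec d \<alpha>) * (\<Prod>i\<in>\<alpha>. g i x) * (\<Prod>j\<in>{1..d} - \<alpha>. 1 - g j x))"
    and "\<And>i. i \<in> {1..d} \<Longrightarrow> fully_alternating k k A (g i)"
    and "fully_alternating d k (\<lambda>_. {0, 1}) f"
  shows "fully_alternating k k A h"
  unfolding fully_alternating_iff
proof (intro allI impI, elim conjE)
  fix P s t
  assume P: "P \<subseteq> {1..k}" "P \<noteq> {}" "card P \<le> k" and t: "\<forall>j\<in>{1..k}. 0 \<le> t j"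
    and box: "\<forall>V\<subseteq>P. shift_vec k s (bitvec k V) t \<in> prod_box k A"
  define x where "x Q = shift_vec k s (bitvec k Q) t" for Q
  have x: "x Q \<in> prod_box k A" if "Q \<subseteq> P" for Q
    using box that by (simp add: x_def)
  have "finite P" using P finite_subset by blast
  have "altsum P (\<lambda>Q. h (x Q)) =
      altsum P (\<lambda>Q. multilinear {1..d} (\<lambda>\<alpha>. f (ind_vec d \<alpha>)) (\<lambda>i. g i (x Q)))"
    by (intro altsum_cong) (simp add: x assms(5) multilinear_def)
  also have "\<dots> \<le> 0"
  proof (rule altsum_multilinear_nonpos)
    fix i U R
    assume i: "i \<in> {1..d}" and UR: "U \<subseteq> P" "R \<subseteq> P" "R \<noteq> {}" "U \<inter> R = {}"
    \<comment> \<open>The face in the directions \<open>R\<close> is based at the vertex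
      \<open>x U\<close>, so alternation of \<open>g i\<close> is applied at that point.\<close>
    have shift: "shift_vec k (x U) (bitvec k V) t = x (U \<union> V)" if "V \<subseteq> R" for V
      unfolding x_def using that UR by (intro shift_vec_shift_vec) auto
    have "card R \<le> k"
      using card_mono[OF \<open>finite P\<close> UR(2)] P(3) by simp
    moreover have "\<forall>V\<subseteq>R. shift_vec k (x U) (bitvec k V) t \<in> prod_box k A"
      using shift x UR by auto
    ultimately have "altsum R (\<lambda>V. g i (shift_vec k (x U) (bitvec k V) t)) \<le> 0"
      using assms(6)[OF i, unfolded fully_alternating_iff, rule_format, of R "x U" t]
        x[OF UR(1)] UR P(1) t by blast
    then show "altsum R (\<lambda>V. g i (x (U \<union> V))) \<le> 0"
      using altsum_cong[of R "\<lambda>V. g i (shift_vec k (x U) (bitvec k V) t)"] shift by simp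
  next
    fix c :: "nat \<Rightarrow> bool" and T :: "nat \<Rightarrow> nat set"
    \<comment> \<open>Transpose the hitting condition: \<open>T i\<close> meets \<open>Q\<close> iff
      some \<open>q \<in> Q\<close> switches on \<open>i\<close>. So each direction \<open>q\<close>
      adds a fixed set of coordinates.\<close>
    have "{i\<in>{1..d}. c i \<or> T i \<inter> Q \<noteq> {}} = {i\<in>{1..d}. c i} \<union> (\<Union>q\<in>Q. {i\<in>{1..d}. q \<in> T i})" for Q
      by auto
    \<comment> \<open>Since \<open>P \<noteq> {}\<close>, only differences of \<open>f\<close> of
      order at least one are requested, and \<open>card P \<le> k\<close> bounds their
      order.\<close>
    moreover have "altsum P (\<lambda>Q. f (ind_vec d ({i\<in>{1..d}. c i} \<union> (\<Union>q\<in>Q. {i\<in>{1..d}. q \<in> T i})))) \<le> 0"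
      using \<open>finite P\<close> P
      by (intro altsum_Union_nonpos[where D = "{1..d}"] fully_alternating_set_function[OF assms(7)]) auto
    ultimately show "altsum P (\<lambda>Q. f (ind_vec d {i\<in>{1..d}. c i \<or> T i \<inter> Q \<noteq> {}})) \<le> 0"
      by simp
  qed (use \<open>finite P\<close> assms(4) x in auto)
  finally show "altsum P (\<lambda>V. h (shift_vec k s (bitvec k V) t)) \<le> 0"
    unfolding x_def .
qed

end
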